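(* Let $K$ be an arbitrary field, let $A$ be the free metabelian anticommutative algebra over $K$ with free generators $x_1,\ldots,x_n$, and let $f\in A^2$. Then the endomorphism $$\delta=(x_1+f,x_2,\ldots,x_n)$$ of $A$ (i.e. $\delta(x_1)=x_1+f$ and $\delta(x_i)=x_i$ for $2\le i\le n$) is an automorphism of $A$ if and only if $\frac{\partial f}{\partial x_1}=0$.
   Context: Algebras are nonassociative and without required unit. An algebra over $K$ is anticommutative if it satisfies the identity $x^2=0$, and metabelian if it satisfies the identity $(xy)(zt)=0$. $A$ is the free algebra on $x_1,\ldots,x_n$ in the variety defined by these two identities, and $A^2=AA$ is the span of all products. Fox derivatives. Let $Y=A/A^2$, with basis $y_1,\ldots,y_n$ (the images of $x_1,\ldots,x_n$). Let $U$ be the free associative algebra with identity over $K$ on free generators $z_1,\ldots,z_n$, and for $a=\sum_i\alpha_iy_i\in Y$ put $R_a=\sum_i\alpha_iz_i\in U$. Let $T$ be the free right $U$-module with free generators $t_1,\ldots,t_n$. The space $Y\oplus T$ is a metabelian anticommutative algebra under $(a_1+m_1)(a_2+m_2)=m_1R_{a_2}-m_2R_{a_1}$ for $a_1,a_2\in Y$, $m_1,m_2\in T$. The homomorphism $\rho:A\to Y\oplus T$ with $\rho(x_i)=y_i+t_i$ is injective, and $A$ is identified with its image. Each $a\in A$ is then uniquely written as $a=y+t_1u_1+\cdots+t_nu_n$ with $y\in Y$, $u_i\in U$, and one sets $\frac{\partial a}{\partial x_i}=u_i$. *)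

theory Defs
  imports "HOL-Analysis.Cartesian_Space" "HOL-Library.Poly_Mapping"
begin

section \<open>Nonassociative algebras over a field\<close>

text \<open>Algebras need be neither associative nor unital.\<close>

locale nonassoc_algebra = vector_space scale
  for scale :: "'k::field \<Rightarrow> 'v::ab_group_add \<Rightarrow> 'v" +
  fixes mult :: "'v \<Rightarrow> 'v \<Rightarrow> 'v"
  assumes mult_add_left: "mult (x + y) z = mult x z + mult y z"
    and mult_add_right: "mult x (y + z) = mult x y + mult x z"
    and mult_scale_left: "mult (scale c x) y = scale c (mult x y)"
    and mult_scale_right: "mult x (scale c y) = scale c (mult x y)"

definition anticommutative :: "('v::zero \<Rightarrow> 'v \<Rightarrow> 'v) \<Rightarrow> bool" where
  "anticommutative mult \<longleftrightarrow> (\<forall>x. mult x x = 0)"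

definition metabelian :: "('v::zero \<Rightarrow> 'v \<Rightarrow> 'v) \<Rightarrow> bool" where
  "metabelian mult \<longleftrightarrow> (\<forall>x y z t. mult (mult x y) (mult z t) = 0)"

definition algebra_hom ::
  "('k::field \<Rightarrow> 'v::ab_group_add \<Rightarrow> 'v) \<Rightarrow> ('v \<Rightarrow> 'v \<Rightarrow> 'v) \<Rightarrow>
   ('k \<Rightarrow> 'w::ab_group_add \<Rightarrow> 'w) \<Rightarrow> ('w \<Rightarrow> 'w \<Rightarrow> 'w) \<Rightarrow> ('v \<Rightarrow> 'w) \<Rightarrow> bool" where
  "algebra_hom s1 m1 s2 m2 \<phi> \<longleftrightarrow>
     Vector_Spaces.linear s1 s2 \<phi> \<and> (\<forall>x y. \<phi> (m1 x y) = m2 (\<phi> x) (\<phi> y))"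

abbreviation algebra_endomorphism ::
  "('k::field \<Rightarrow> 'v::ab_group_add \<Rightarrow> 'v) \<Rightarrow> ('v \<Rightarrow> 'v \<Rightarrow> 'v) \<Rightarrow> ('v \<Rightarrow> 'v) \<Rightarrow> bool" where
  "algebra_endomorphism s m \<phi> \<equiv> algebra_hom s m s m \<phi>"

definition algebra_automorphism ::
  "('k::field \<Rightarrow> 'v::ab_group_add \<Rightarrow> 'v) \<Rightarrow> ('v \<Rightarrow> 'v \<Rightarrow> 'v) \<Rightarrow> ('v \<Rightarrow> 'v) \<Rightarrow> bool" where
  "algebra_automorphism s m \<phi> \<longleftrightarrow> algebra_endomorphism s m \<phi> \<and> bij \<phi>"


section \<open>Spaces with a prescribed basis\<close>

definition pm_scale :: "'k::field \<Rightarrow> ('a \<Rightarrow>\<^sub>0 'k) \<Rightarrow> ('a \<Rightarrow>\<^sub>0 'k)" where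
  "pm_scale c p = Poly_Mapping.map ((*) c) p"

lemma lookup_pm_scale [simp]:
  "Poly_Mapping.lookup (pm_scale c p) k = c * Poly_Mapping.lookup p k"
  unfolding pm_scale_def by transfer (simp add: when_def)

lemma pm_scale_single [simp]:
  "pm_scale c (Poly_Mapping.single k d) = Poly_Mapping.single k (c * d)"
  by (rule poly_mapping_eqI) (simp add: lookup_single when_def)

interpretation pm: vector_space pm_scale
  by unfold_locales (auto intro!: poly_mapping_eqI simp: lookup_add algebra_simps)

definition lin_ext ::
  "('k::field \<Rightarrow> 'v::ab_group_add \<Rightarrow> 'v) \<Rightarrow> ('a \<Rightarrow> 'v) \<Rightarrow> ('a \<Rightarrow>\<^sub>0 'k) \<Rightarrow> 'v" where
  "lin_ext s f p = (\<Sum>k\<in>Poly_Mapping.keys p. s (Poly_Mapping.lookup p k) (f k))"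

context vector_space
begin

lemma lin_ext_superset:
  assumes "finite A" "Poly_Mapping.keys p \<subseteq> A"
  shows "lin_ext scale f p = (\<Sum>k\<in>A. scale (Poly_Mapping.lookup p k) (f k))"
  unfolding lin_ext_def using assms
  by (intro sum.mono_neutral_left) (auto simp: in_keys_iff)

lemma lin_ext_add: "lin_ext scale f (p + q) = lin_ext scale f p + lin_ext scale f q"
proof -
  let ?A = "Poly_Mapping.keys p \<union> Poly_Mapping.keys q"
  have "Poly_Mapping.keys (p + q) \<subseteq> ?A"
    by (rule Poly_Mapping.keys_add)
  then show ?thesis
    by (simp add: lin_ext_superset[of ?A] lookup_add scale_left_distrib sum.distrib)
qed

lemma lin_ext_scale: "lin_ext scale f (pm_scale c p) = scale c (lin_ext scale f p)"
proof -
  have "Poly_Mapping.keys (pm_scale c p) \<subseteq> Poly_Mapping.keys p"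
    by (auto simp: in_keys_iff)
  then show ?thesis
    by (simp add: lin_ext_superset[of "Poly_Mapping.keys p"] scale_sum_right)
qed

lemma lin_ext_single [simp]: "lin_ext scale f (Poly_Mapping.single k c) = scale c (f k)"
  by (simp add: lin_ext_superset[of "{k}"])

lemma linear_lin_ext: "Vector_Spaces.linear pm_scale scale (lin_ext scale f)"
  by unfold_locales (auto simp: lin_ext_add lin_ext_scale)

end

lemma linear_lin_ext_comp:
  assumes "Vector_Spaces.linear s1 s2 L"
  shows "L (lin_ext s1 f p) = lin_ext s2 (\<lambda>k. L (f k)) p"
proof -
  interpret L: Vector_Spaces.linear s1 s2 L by fact
  show ?thesis by (simp add: lin_ext_def L.sum L.scale)
qed

lemma lin_ext_id: "lin_ext pm_scale (\<lambda>k. Poly_Mapping.single k 1) p = p"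
proof (rule poly_mapping_eqI)
  fix k
  have "Poly_Mapping.lookup (lin_ext pm_scale (\<lambda>k. Poly_Mapping.single k 1) p) k =
      (\<Sum>j\<in>Poly_Mapping.keys p. if j = k then Poly_Mapping.lookup p j else 0)"
    by (simp add: lin_ext_def lookup_sum lookup_single when_def)
  also have "\<dots> = Poly_Mapping.lookup p k"
    by (simp add: in_keys_iff)
  finally show "Poly_Mapping.lookup (lin_ext pm_scale (\<lambda>k. Poly_Mapping.single k 1) p) k =
      Poly_Mapping.lookup p k" .
qed


section \<open>The free nonassociative algebra\<close>

text \<open>The basis is the free magma on the generators, i.e. the set of bracketed words.\<close>

datatype 'n magma = Leaf 'n | Node "'n magma" "'n magma"

type_synonym ('k, 'n) free_na = "'n magma \<Rightarrow>\<^sub>0 'k"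

definition na_mult :: "('k::field, 'n) free_na \<Rightarrow> ('k, 'n) free_na \<Rightarrow> ('k, 'n) free_na" where
  "na_mult p q =
     lin_ext pm_scale (\<lambda>a. lin_ext pm_scale (\<lambda>b. Poly_Mapping.single (Node a b) 1) q) p"

lemma na_mult_single [simp]:
  "na_mult (Poly_Mapping.single a c) (Poly_Mapping.single b d) =
     Poly_Mapping.single (Node a b) (c * d)"
  by (simp add: na_mult_def)

interpretation na: nonassoc_algebra pm_scale na_mult
proof
  fix x y z :: "('k::field, 'n) free_na" and c :: 'k
  have add: "lin_ext pm_scale (\<lambda>a. f a + g a) x = lin_ext pm_scale f x + lin_ext pm_scale g x"
    for f g :: "'n magma \<Rightarrow> ('k, 'n) free_na"
    by (simp add: lin_ext_def pm.scale_right_distrib sum.distrib)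
  have scl: "lin_ext pm_scale (\<lambda>a. pm_scale c (f a)) x = pm_scale c (lin_ext pm_scale f x)"
    for f :: "'n magma \<Rightarrow> ('k, 'n) free_na"
    by (simp add: lin_ext_def pm.scale_sum_right mult.commute)
  show "na_mult (x + y) z = na_mult x z + na_mult y z"
    by (simp add: na_mult_def pm.lin_ext_add)
  show "na_mult (pm_scale c x) y = pm_scale c (na_mult x y)"
    by (simp add: na_mult_def pm.lin_ext_scale)
  show "na_mult x (y + z) = na_mult x y + na_mult x z"
    by (simp add: na_mult_def pm.lin_ext_add add)
  show "na_mult x (pm_scale c y) = pm_scale c (na_mult x y)"
    by (simp add: na_mult_def pm.lin_ext_scale scl)
qed


section \<open>The free metabelian anticommutative algebra\<close>

text \<open>
  The ideal generated by all values of the two identities in the free nonassociative algebra.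
\<close>

inductive_set ma_ideal :: "('k::field, 'n) free_na set" where
  square: "na_mult u u \<in> ma_ideal"
| product: "na_mult (na_mult u v) (na_mult w t) \<in> ma_ideal"
| add: "p \<in> ma_ideal \<Longrightarrow> q \<in> ma_ideal \<Longrightarrow> p + q \<in> ma_ideal"
| scale: "p \<in> ma_ideal \<Longrightarrow> pm_scale c p \<in> ma_ideal"
| mult_left: "p \<in> ma_ideal \<Longrightarrow> na_mult u p \<in> ma_ideal"
| mult_right: "p \<in> ma_ideal \<Longrightarrow> na_mult p u \<in> ma_ideal"

lemma ma_ideal_zero: "0 \<in> ma_ideal"
  using ma_ideal.scale[OF ma_ideal.square, of 0] by simp

lemma ma_ideal_minus: "p \<in> ma_ideal \<Longrightarrow> - p \<in> ma_ideal"
  using ma_ideal.scale[of p "-1"] by simp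

definition ma_cong :: "('k::field, 'n) free_na \<Rightarrow> ('k, 'n) free_na \<Rightarrow> bool" where
  "ma_cong p q \<longleftrightarrow> p - q \<in> ma_ideal"

quotient_type (overloaded) ('k, 'n) free_ma = "('k::field, 'n) free_na" / ma_cong
proof (rule equivpI)
  show "reflp ma_cong"
    by (simp add: reflp_def ma_cong_def ma_ideal_zero)
  show "symp ma_cong"
    using ma_ideal_minus by (fastforce simp: symp_def ma_cong_def)
  show "transp ma_cong"
    using ma_ideal.add by (fastforce simp: transp_def ma_cong_def)
qed

instantiation free_ma :: (field, type) ab_group_add
begin

lift_definition zero_free_ma :: "('a, 'b) free_ma" is 0 .

lift_definition plus_free_ma :: "('a, 'b) free_ma \<Rightarrow> ('a, 'b) free_ma \<Rightarrow> ('a, 'b) free_ma" is "(+)"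
  unfolding ma_cong_def by (metis add_diff_add ma_ideal.add)

lift_definition uminus_free_ma :: "('a, 'b) free_ma \<Rightarrow> ('a, 'b) free_ma" is uminus
  unfolding ma_cong_def by (metis minus_diff_minus ma_ideal_minus)

lift_definition minus_free_ma :: "('a, 'b) free_ma \<Rightarrow> ('a, 'b) free_ma \<Rightarrow> ('a, 'b) free_ma" is "(-)"
proof -
  fix p p' q q' :: "('a, 'b) free_na"
  assume "ma_cong p p'" "ma_cong q q'"
  then have "(p - p') + - (q - q') \<in> ma_ideal"
    unfolding ma_cong_def by (intro ma_ideal.add ma_ideal_minus)
  then show "ma_cong (p - q) (p' - q')"
    unfolding ma_cong_def by (simp add: algebra_simps)
qed

instance
  by standard (transfer; simp add: ma_cong_def ma_ideal_zero algebra_simps)+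

end

instantiation free_ma :: (field, type) times
begin

lift_definition times_free_ma :: "('a, 'b) free_ma \<Rightarrow> ('a, 'b) free_ma \<Rightarrow> ('a, 'b) free_ma" is na_mult
proof -
  fix p p' q q' :: "('a, 'b) free_na"
  assume "ma_cong p p'" "ma_cong q q'"
  then have "na_mult (p - p') q + na_mult p' (q - q') \<in> ma_ideal"
    unfolding ma_cong_def by (intro ma_ideal.intros)
  moreover have "na_mult (p - p') q + na_mult p' (q - q') = na_mult p q - na_mult p' q'"
    using na.mult_add_left[of "p - p'" p' q] na.mult_add_right[of p' "q - q'" q']
    by (simp add: algebra_simps)
  ultimately show "ma_cong (na_mult p q) (na_mult p' q')"
    unfolding ma_cong_def by simp
qed

instance ..

end

lift_definition ma_scale :: "'k::field \<Rightarrow> ('k, 'n) free_ma \<Rightarrow> ('k, 'n) free_ma" is pm_scale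
  unfolding ma_cong_def by (metis ma_ideal.scale pm.scale_right_diff_distrib)

lift_definition gen :: "'n \<Rightarrow> ('k::field, 'n) free_ma" is "\<lambda>i. Poly_Mapping.single (Leaf i) 1" .

interpretation ma: nonassoc_algebra "ma_scale :: 'k::field \<Rightarrow> ('k, 'n) free_ma \<Rightarrow> _" "(*)"
  by unfold_locales
    (transfer; simp add: ma_cong_def ma_ideal_zero pm.scale_right_distrib pm.scale_left_distrib
      na.mult_add_left na.mult_add_right na.mult_scale_left na.mult_scale_right)+

lemma anticommutative_free_ma: "anticommutative ((*) :: ('k::field, 'n) free_ma \<Rightarrow> _)"
  unfolding anticommutative_def by transfer (simp add: ma_cong_def ma_ideal.square)

lemma metabelian_free_ma: "metabelian ((*) :: ('k::field, 'n) free_ma \<Rightarrow> _)"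
  unfolding metabelian_def by transfer (simp add: ma_cong_def ma_ideal.product)

text \<open>The square of the algebra, i.e. the span of all products.\<close>

definition ma_square :: "('k::field, 'n) free_ma set" where
  "ma_square = module.span ma_scale {a * b | a b. True}"

text \<open>
  The universal property: maps from the generators into a metabelian anticommutative algebra
  extend uniquely to homomorphisms.
\<close>

primrec magma_eval :: "('v \<Rightarrow> 'v \<Rightarrow> 'v) \<Rightarrow> ('n \<Rightarrow> 'v) \<Rightarrow> 'n magma \<Rightarrow> 'v" where
  "magma_eval m g (Leaf i) = g i"
| "magma_eval m g (Node a b) = m (magma_eval m g a) (magma_eval m g b)"

theorem free_ma_universal:
  fixes s :: "'k::field \<Rightarrow> 'v::ab_group_add \<Rightarrow> 'v" and g :: "'n \<Rightarrow> 'v"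
  assumes "nonassoc_algebra s m" and anti: "anticommutative m" and meta: "metabelian m"
  shows "\<exists>!\<phi>. algebra_hom ma_scale (*) s m \<phi> \<and> (\<forall>i. \<phi> (gen i) = g i)"
proof -
  interpret B: nonassoc_algebra s m by fact
  define H where "H = lin_ext s (magma_eval m g)"
  have lin: "Vector_Spaces.linear pm_scale s H"
    unfolding H_def by (rule B.linear_lin_ext)
  interpret H: Vector_Spaces.linear pm_scale s H by (rule lin)
  have L1: "Vector_Spaces.linear s s (\<lambda>x. m x y)" for y
    by unfold_locales (simp_all add: B.mult_add_left B.mult_scale_left)
  have L2: "Vector_Spaces.linear s s (m x)" for x
    by unfold_locales (simp_all add: B.mult_add_right B.mult_scale_right)
  have Hsingle: "H (Poly_Mapping.single a 1) = magma_eval m g a" for a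
    by (simp add: H_def)
  have Hmult: "H (na_mult p q) = m (H p) (H q)" for p q
  proof -
    have "H (na_mult p q) =
        lin_ext s (\<lambda>a. lin_ext s (\<lambda>b. m (magma_eval m g a) (magma_eval m g b)) q) p"
      by (simp add: na_mult_def linear_lin_ext_comp[OF lin] Hsingle)
    also have "\<dots> = lin_ext s (\<lambda>a. m (magma_eval m g a) (H q)) p"
      by (simp add: H_def linear_lin_ext_comp[OF L2])
    also have "\<dots> = m (H p) (H q)"
      by (simp add: H_def linear_lin_ext_comp[OF L1])
    finally show ?thesis .
  qed
  have m0: "m 0 x = 0" "m x 0 = 0" for x
    using B.mult_scale_left[of 0 0 x] B.mult_scale_right[of x 0 0] by simp_all
  have Hideal: "H p = 0" if "p \<in> ma_ideal" for p
    using that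
  proof induction
    case (square u)
    then show ?case using anti by (simp add: Hmult anticommutative_def)
  next
    case (product u v w t)
    then show ?case using meta by (simp add: Hmult metabelian_def)
  qed (simp_all add: H.add H.scale Hmult m0)
  have Hcong: "H p = H q" if "ma_cong p q" for p q
    using Hideal[of "p - q"] that by (simp add: ma_cong_def H.diff)
  define \<phi> where "\<phi> a = H (rep_free_ma a)" for a
  have \<phi>_abs: "\<phi> (abs_free_ma p) = H p" for p
    unfolding \<phi>_def
    by (rule Hcong) (simp add: free_ma.abs_eq_iff[symmetric] Quotient_abs_rep[OF Quotient_free_ma])
  have surj: "\<exists>p. a = abs_free_ma p" for a :: "('k, 'n) free_ma"
    by (metis Quotient_abs_rep Quotient_free_ma)
  have abs: "abs_free_ma p + abs_free_ma q = abs_free_ma (p + q)"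
    "abs_free_ma p * abs_free_ma q = abs_free_ma (na_mult p q)"
    "ma_scale c (abs_free_ma p) = abs_free_ma (pm_scale c p)" for p q and c :: 'k
    by (simp_all add: plus_free_ma.abs_eq times_free_ma.abs_eq ma_scale.abs_eq)
  have "Vector_Spaces.linear ma_scale s \<phi>"
  proof unfold_locales
    fix a b :: "('k, 'n) free_ma" and c :: 'k
    obtain p q where "a = abs_free_ma p" "b = abs_free_ma q"
      using surj[of a] surj[of b] by auto
    then show "\<phi> (a + b) = \<phi> a + \<phi> b" "\<phi> (ma_scale c a) = s c (\<phi> a)"
      by (simp_all add: abs \<phi>_abs H.add H.scale)
  qed
  moreover have "\<phi> (a * b) = m (\<phi> a) (\<phi> b)" for a b
  proof -
    obtain p q where "a = abs_free_ma p" "b = abs_free_ma q"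
      using surj[of a] surj[of b] by auto
    then show ?thesis by (simp add: abs \<phi>_abs Hmult)
  qed
  moreover have "\<phi> (gen i) = g i" for i
    by (simp add: gen.abs_eq \<phi>_abs Hsingle)
  ultimately have ex: "algebra_hom ma_scale (*) s m \<phi> \<and> (\<forall>i. \<phi> (gen i) = g i)"
    by (simp add: algebra_hom_def)
  have uniq: "\<psi> = \<phi>" if \<psi>: "algebra_hom ma_scale (*) s m \<psi> \<and> (\<forall>i. \<psi> (gen i) = g i)" for \<psi>
  proof
    fix a :: "('k, 'n) free_ma"
    have lin\<psi>: "Vector_Spaces.linear ma_scale s \<psi>"
      using \<psi> by (simp add: algebra_hom_def)
    interpret P: Vector_Spaces.linear ma_scale s \<psi> by (rule lin\<psi>)
    have lin2: "Vector_Spaces.linear pm_scale s (\<lambda>p. \<psi> (abs_free_ma p))"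
      by unfold_locales (simp_all add: abs[symmetric] P.add P.scale)
    have single: "\<psi> (abs_free_ma (Poly_Mapping.single t 1)) = magma_eval m g t" for t
    proof (induction t)
      case (Leaf i)
      then show ?case using \<psi> by (simp add: gen.abs_eq[symmetric])
    next
      case (Node t u)
      have "abs_free_ma (Poly_Mapping.single (Node t u) (1::'k)) =
          abs_free_ma (Poly_Mapping.single t 1) * abs_free_ma (Poly_Mapping.single u 1)"
        by (simp add: abs)
      then show ?case using \<psi> Node by (simp add: algebra_hom_def)
    qed
    obtain p where p: "a = abs_free_ma p"
      using surj by blast
    have "\<psi> (abs_free_ma p) = \<psi> (abs_free_ma (lin_ext pm_scale (\<lambda>k. Poly_Mapping.single k 1) p))"
      by (simp add: lin_ext_id)
    also have "\<dots> = H p"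
      by (simp add: linear_lin_ext_comp[OF lin2] single H_def)
    finally show "\<psi> a = \<phi> a"
      by (simp add: p \<phi>_abs)
  qed
  show ?thesis
    using ex uniq by blast
qed

corollary free_ma_endomorphism:
  fixes g :: "'n \<Rightarrow> ('k::field, 'n) free_ma"
  shows "\<exists>!\<delta>. algebra_endomorphism ma_scale (*) \<delta> \<and> (\<forall>i. \<delta> (gen i) = g i)"
  by (rule free_ma_universal[OF ma.nonassoc_algebra_axioms anticommutative_free_ma
        metabelian_free_ma])


section \<open>Fox derivatives\<close>

text \<open>
  Words under concatenation, written additively because \<open>\<Rightarrow>\<^sub>0\<close> forms monoid
  algebras over additively written monoids.
\<close>

datatype 'n fmon = FMon "'n list"

instantiation fmon :: (type) monoid_add
begin

definition zero_fmon :: "'a fmon" where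
  "zero_fmon = FMon []"

fun plus_fmon :: "'a fmon \<Rightarrow> 'a fmon \<Rightarrow> 'a fmon" where
  "plus_fmon (FMon u) (FMon v) = FMon (u @ v)"

instance
proof
  fix a b c :: "'a fmon"
  show "a + b + c = a + (b + c)"
    by (cases a; cases b; cases c) simp
  show "0 + a = a" "a + 0 = a"
    by (cases a; simp add: zero_fmon_def)+
qed

end

type_synonym ('k, 'n) free_assoc = "'n fmon \<Rightarrow>\<^sub>0 'k"

text \<open>
  The algebra $Y \oplus T$. Here $Y$ is \<open>'k ^ 'n\<close> with basis \<open>y\<^sub>i = axis i 1\<close>, and $T$ is the
  free right module \<open>('k, 'n) free_assoc ^ 'n\<close> with free generators \<open>t\<^sub>i = axis i 1\<close>, so that the
  coefficient $u_i$ of \<open>t\<^sub>i\<close> in \<open>m\<close> is \<open>m $ i\<close> and the right action multiplies every coefficient on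
  the right.
\<close>

type_synonym ('k, 'n) fox_module = "('k, 'n) free_assoc ^ 'n"
type_synonym ('k, 'n) fox_algebra = "('k ^ 'n) \<times> ('k, 'n) fox_module"

definition right_act ::
  "('k::field, 'n::finite) fox_module \<Rightarrow> ('k, 'n) free_assoc \<Rightarrow> ('k, 'n) fox_module" where
  "right_act m u = (\<chi> i. m $ i * u)"

definition R :: "'k::field ^ 'n::finite \<Rightarrow> ('k, 'n) free_assoc" where
  "R a = (\<Sum>i\<in>UNIV. pm_scale (a $ i) (Poly_Mapping.single (FMon [i]) 1))"

definition fox_scale ::
  "'k::field \<Rightarrow> ('k, 'n::finite) fox_algebra \<Rightarrow> ('k, 'n) fox_algebra" where
  "fox_scale c v = (c *s fst v, \<chi> i. pm_scale c (snd v $ i))"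

definition fox_mult ::
  "('k::field, 'n::finite) fox_algebra \<Rightarrow> ('k, 'n) fox_algebra \<Rightarrow> ('k, 'n) fox_algebra" where
  "fox_mult v w = (0, right_act (snd v) (R (fst w)) - right_act (snd w) (R (fst v)))"

lemma pm_scale_mult_left:
  fixes p q :: "('k::field, 'n) free_assoc"
  shows "pm_scale c p * q = pm_scale c (p * q)"
  unfolding pm_scale_def by (simp add: mult_map_scale_conv_mult mult.assoc)

lemma pm_scale_mult_right:
  fixes p q :: "('k::field, 'n) free_assoc"
  shows "p * pm_scale c q = pm_scale c (p * q)"
proof -
  have L: "Vector_Spaces.linear pm_scale pm_scale (\<lambda>p. p * u)" for u :: "('k, 'n) free_assoc"
    by unfold_locales (simp_all add: pm_scale_mult_left algebra_simps)
  have lin: "Vector_Spaces.linear pm_scale pm_scale (\<lambda>p::('k, 'n) free_assoc. pm_scale c p)"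
    by unfold_locales (simp_all add: pm.scale_right_distrib mult.commute)
  have 1: "Poly_Mapping.single k (1::'k) * pm_scale c q = pm_scale c (Poly_Mapping.single k 1 * q)"
    for k :: "'n fmon"
  proof -
    have *: "Poly_Mapping.single k (1::'k) * Poly_Mapping.single 0 c =
        Poly_Mapping.single 0 c * Poly_Mapping.single k 1"
      by (simp add: mult_single)
    show ?thesis
      by (simp only: pm_scale_def mult_map_scale_conv_mult mult.assoc[symmetric] *)
  qed
  have "lin_ext pm_scale (\<lambda>k. Poly_Mapping.single k 1) p * pm_scale c q =
      pm_scale c (lin_ext pm_scale (\<lambda>k. Poly_Mapping.single k 1) p * q)"
    by (simp only: linear_lin_ext_comp[OF L] linear_lin_ext_comp[OF lin] 1)
  then show ?thesis
    by (simp add: lin_ext_id)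
qed

lemma R_add: "R (a + b) = R a + R b"
  by (simp only: R_def vector_add_component pm.scale_left_distrib sum.distrib)

lemma R_scale: "R (c *s a) = pm_scale c (R a)"
  by (simp add: R_def pm.scale_sum_right)

lemma R_zero: "R 0 = 0"
  by (simp add: R_def)

interpretation fox: nonassoc_algebra fox_scale fox_mult
proof
  fix x y z :: "('k::field, 'n::finite) fox_algebra" and c d :: 'k
  show "fox_scale c (x + y) = fox_scale c x + fox_scale c y"
    by (simp add: fox_scale_def prod_eq_iff vec_eq_iff distrib_left pm.scale_right_distrib)
  show "fox_scale (c + d) x = fox_scale c x + fox_scale d x"
    by (simp add: fox_scale_def prod_eq_iff vec_eq_iff distrib_right pm.scale_left_distrib)
  show "fox_scale c (fox_scale d x) = fox_scale (c * d) x"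
    by (simp add: fox_scale_def prod_eq_iff vec_eq_iff mult.assoc)
  show "fox_scale 1 x = x"
    by (simp add: fox_scale_def prod_eq_iff vec_eq_iff)
  show "fox_mult (x + y) z = fox_mult x z + fox_mult y z"
    by (simp add: fox_mult_def right_act_def prod_eq_iff vec_eq_iff R_add distrib_left distrib_right)
  show "fox_mult x (y + z) = fox_mult x y + fox_mult x z"
    by (simp add: fox_mult_def right_act_def prod_eq_iff vec_eq_iff R_add distrib_left distrib_right)
  show "fox_mult (fox_scale c x) y = fox_scale c (fox_mult x y)"
    by (simp add: fox_scale_def fox_mult_def right_act_def prod_eq_iff vec_eq_iff R_scale
        pm_scale_mult_left pm_scale_mult_right pm.scale_right_diff_distrib)
  show "fox_mult x (fox_scale c y) = fox_scale c (fox_mult x y)"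
    by (simp add: fox_scale_def fox_mult_def right_act_def prod_eq_iff vec_eq_iff R_scale
        pm_scale_mult_left pm_scale_mult_right pm.scale_right_diff_distrib)
qed

lemma anticommutative_fox: "anticommutative fox_mult"
  by (simp add: anticommutative_def fox_mult_def zero_prod_def)

lemma metabelian_fox: "metabelian fox_mult"
  by (simp add: metabelian_def fox_mult_def right_act_def R_zero vec_eq_iff zero_prod_def)

definition rho :: "('k::field, 'n::finite) free_ma \<Rightarrow> ('k, 'n) fox_algebra" where
  "rho = (THE \<phi>. algebra_hom ma_scale (*) fox_scale fox_mult \<phi> \<and>
                 (\<forall>i. \<phi> (gen i) = (axis i 1, axis i 1)))"

lemma rho_hom: "algebra_hom ma_scale (*) fox_scale fox_mult rho"
  and rho_gen: "rho (gen i) = (axis i 1, axis i 1)"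
  using theI'[OF free_ma_universal[OF fox.nonassoc_algebra_axioms anticommutative_fox
    metabelian_fox, of "\<lambda>i. (axis i 1, axis i 1)"]]
  unfolding rho_def by blast+

definition fox_deriv :: "'n::finite \<Rightarrow> ('k::field, 'n) free_ma \<Rightarrow> ('k, 'n) free_assoc" where
  "fox_deriv i a = snd (rho a) $ i"

lemma snd_rho_eq: "snd (rho a) = (\<Sum>i\<in>UNIV. right_act (axis i 1) (fox_deriv i a))"
proof -
  have "(\<Sum>i\<in>UNIV. right_act (axis i 1) (fox_deriv i a)) $ j = fox_deriv j a" for j
  proof -
    have "(\<Sum>i\<in>UNIV. right_act (axis i 1) (fox_deriv i a)) $ j =
        (\<Sum>i\<in>UNIV. if j = i then fox_deriv i a else 0)"
      unfolding sum_component right_act_def axis_def by (rule sum.cong) auto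
    then show ?thesis by simp
  qed
  then show ?thesis by (simp add: vec_eq_iff fox_deriv_def)
qed

end

theory Submission
  imports Defs
begin

text \<open>
  Write $D f$ for the component of $\rho(f)$ in $T$. The homomorphisms $\rho \circ \delta$ and
  $\sigma \circ \rho$, where $\sigma(y, m) = (y, m + (D f) m_1)$, agree on the generators, hence
  everywhere; in particular $\partial_1(\delta a) = (1 + \partial_1 f) \partial_1 a$. If $\delta$ is
  onto, a preimage of $x_1$ shows that $1 + \partial_1 f$ has a right inverse in $U$, so it is a
  constant by degrees, and $\partial_1 f$ has no constant term because $f \in A^2$. Conversely, if
  $\partial_1 f = 0$ then $\rho(\delta f) = \rho(f)$, so $\delta f = f$ as $\rho$ is injective, and
  $x_1 \mapsto x_1 - f$ gives the inverse of $\delta$.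
\<close>

section \<open>The free associative algebra\<close>

fun fmon_length :: "'n fmon \<Rightarrow> nat" where
  "fmon_length (FMon w) = length w"

lemma fmon_length_zero_iff: "fmon_length w = 0 \<longleftrightarrow> w = 0"
  by (cases w) (simp add: zero_fmon_def)

lemma fmon_length_add: "fmon_length (u + v) = fmon_length u + fmon_length v"
  by (cases u; cases v) simp

lemma fmon_add_eq_zero_iff: "u + v = 0 \<longleftrightarrow> u = 0 \<and> v = (0 :: 'n fmon)"
  by (cases u; cases v) (simp add: zero_fmon_def)

text \<open>Lengths add under concatenation, so the two bounds force equal lengths, and a word
  splits in only one way at a given position.\<close>

lemma fmon_add_eq_addD:
  assumes "u + v = u' + v'" "fmon_length u' \<le> fmon_length u" "fmon_length v' \<le> fmon_length v"
  shows "u' = u \<and> v' = v"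
proof -
  have "fmon_length u' = fmon_length u"
    using assms fmon_length_add[of u v] fmon_length_add[of u' v'] by simp
  moreover obtain w x w' x' where uv: "u = FMon w" "v = FMon x" "u' = FMon w'" "v' = FMon x'"
    by (metis fmon_length.cases)
  moreover have "w @ x = w' @ x'"
    using assms(1) unfolding uv by simp
  ultimately have "w = w'" "x = x'"
    by (metis append_eq_append_conv fmon_length.simps)+
  then show ?thesis
    by (simp add: uv)
qed

text \<open>This takes the place of multiplying leading coefficients. Several words may share the
  maximal length, but \<open>u + v\<close> splits into supported words no longer than
  \<open>u\<close> and \<open>v\<close> only as that pair, so its coefficient is a single
  product.\<close>

lemma lookup_mult_fmon_max:
  fixes p q :: "('k::field, 'n) free_assoc"
  assumes p: "\<And>u'. u' \<in> Poly_Mapping.keys p \<Longrightarrow> fmon_length u' \<le> fmon_length u"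
    and q: "\<And>v'. v' \<in> Poly_Mapping.keys q \<Longrightarrow> fmon_length v' \<le> fmon_length v"
  shows "Poly_Mapping.lookup (p * q) (u + v) = Poly_Mapping.lookup p u * Poly_Mapping.lookup q v"
proof -
  have inner: "Poly_Mapping.lookup p u' *
        Sum_any (\<lambda>v'. Poly_Mapping.lookup q v' when u + v = u' + v') =
      (Poly_Mapping.lookup p u * Poly_Mapping.lookup q v when u' = u)" for u'
  proof (cases "Poly_Mapping.lookup p u' = 0")
    case False
    have eq: "(Poly_Mapping.lookup q v' when u + v = u' + v') =
        ((Poly_Mapping.lookup q v when u' = u) when v' = v)" for v'
    proof (cases "Poly_Mapping.lookup q v' = 0")
      case v': False
      then have "u + v = u' + v' \<longleftrightarrow> u' = u \<and> v' = v"
        using fmon_add_eq_addD[of u v u' v'] p[of u'] q[of v'] False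
        by (metis in_keys_iff)
      then show ?thesis
        by (simp add: when_def)
    next
      case True
      then show ?thesis by (auto simp: when_def)
    qed
    show ?thesis
      unfolding eq by (simp add: when_def)
  qed (auto simp: when_def)
  show ?thesis
    unfolding lookup_mult inner by simp
qed

text \<open>The empty word factors only into empty words, so taking the constant term is
  multiplicative.\<close>

lemma lookup_mult_fmon_zero:
  fixes p q :: "('k::field, 'n) free_assoc"
  shows "Poly_Mapping.lookup (p * q) 0 = Poly_Mapping.lookup p 0 * Poly_Mapping.lookup q 0"
proof -
  have inner: "Sum_any (\<lambda>v. Poly_Mapping.lookup q v when 0 = u + v) =
      (Poly_Mapping.lookup q 0 when u = 0)" for u
  proof -
    have eq: "(Poly_Mapping.lookup q v when 0 = u + v) =
        ((Poly_Mapping.lookup q 0 when u = 0) when v = 0)" for v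
      using fmon_add_eq_zero_iff[of u v] by (auto simp: when_def)
    show ?thesis
      unfolding eq by simp
  qed
  have eq: "Poly_Mapping.lookup p u * (Poly_Mapping.lookup q 0 when u = 0) =
      (Poly_Mapping.lookup p 0 * Poly_Mapping.lookup q 0 when u = 0)" for u
    by (auto simp: when_def)
  show ?thesis
    unfolding lookup_mult inner eq by simp
qed

lemma obtain_longest_key:
  fixes p :: "('k::field, 'n) free_assoc"
  assumes "p \<noteq> 0"
  obtains u where "u \<in> Poly_Mapping.keys p"
    "\<And>u'. u' \<in> Poly_Mapping.keys p \<Longrightarrow> fmon_length u' \<le> fmon_length u"
proof -
  have "finite (fmon_length ` Poly_Mapping.keys p)" "fmon_length ` Poly_Mapping.keys p \<noteq> {}"
    using assms by simp_all
  from Max_in[OF this] obtain u where "u \<in> Poly_Mapping.keys p"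
    "fmon_length u = Max (fmon_length ` Poly_Mapping.keys p)" by auto
  then show ?thesis
    by (intro that[of u]) auto
qed

text \<open>For longest words u of p and v of q, the coefficient of uv in pq is a product of nonzero
  scalars. As 1 is supported on the empty word, uv is empty, hence so is u, and p has no longer
  words.\<close>

lemma free_assoc_unit_const:
  fixes p q :: "('k::field, 'n) free_assoc"
  assumes "p * q = 1"
  shows "p = Poly_Mapping.single 0 (Poly_Mapping.lookup p 0)"
proof -
  have "p \<noteq> 0" "q \<noteq> 0"
    using assms by auto
  obtain u where u: "u \<in> Poly_Mapping.keys p"
    "\<And>u'. u' \<in> Poly_Mapping.keys p \<Longrightarrow> fmon_length u' \<le> fmon_length u"
    using obtain_longest_key[OF \<open>p \<noteq> 0\<close>] by blast
  obtain v where v: "v \<in> Poly_Mapping.keys q"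
    "\<And>v'. v' \<in> Poly_Mapping.keys q \<Longrightarrow> fmon_length v' \<le> fmon_length v"
    using obtain_longest_key[OF \<open>q \<noteq> 0\<close>] by blast
  have "Poly_Mapping.lookup (p * q) (u + v) = Poly_Mapping.lookup p u * Poly_Mapping.lookup q v"
    using u(2) v(2) by (rule lookup_mult_fmon_max)
  then have "Poly_Mapping.lookup (p * q) (u + v) \<noteq> 0"
    using u(1) v(1) by (simp add: in_keys_iff)
  then have "u + v = 0"
    by (simp add: assms lookup_one when_def split: if_splits)
  then have "fmon_length u = 0"
    by (simp add: fmon_add_eq_zero_iff fmon_length_zero_iff)
  then have "Poly_Mapping.lookup p w = 0" if "w \<noteq> 0" for w
    using u(2)[of w] that by (metis in_keys_iff le_zero_eq fmon_length_zero_iff)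
  then show ?thesis
    by (intro poly_mapping_eqI) (auto simp: lookup_single when_def)
qed

lemma R_axis: "R (axis j 1) = Poly_Mapping.single (FMon [j]) 1"
proof -
  have "R (axis j 1) =
      (\<Sum>i\<in>UNIV. if i = j then Poly_Mapping.single (FMon [i]) (1::'b) else 0)"
    unfolding R_def by (rule sum.cong) (auto simp: axis_def)
  then show ?thesis by simp
qed

lemma lookup_R_zero: "Poly_Mapping.lookup (R a) 0 = 0"
  by (simp add: R_def lookup_sum lookup_single zero_fmon_def)


section \<open>Left-normed words span the free algebra\<close>

text \<open>Starting from a product of two generators puts every such word in A^2, so the metabelian
  identity annihilates the product of any two of them.\<close>

definition left_normed :: "'n \<Rightarrow> 'n \<Rightarrow> 'n list \<Rightarrow> ('k::field, 'n) free_ma" where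
  "left_normed i j w = foldl (\<lambda>a k. a * gen k) (gen i * gen j) w"

lemma left_normed_Nil: "left_normed i j [] = gen i * gen j"
  by (simp add: left_normed_def)

lemma left_normed_snoc: "left_normed i j (w @ [k]) = left_normed i j w * gen k"
  by (simp add: left_normed_def)

lemma left_normed_is_product: "\<exists>a b. left_normed i j w = a * b"
  by (cases w rule: rev_cases) (auto simp: left_normed_Nil left_normed_snoc)

lemma left_normed_mult_left_normed: "left_normed i j v * left_normed k l w = 0"
  using left_normed_is_product[of i j v] left_normed_is_product[of k l w] metabelian_free_ma
  unfolding metabelian_def by metis

text \<open>Polarization of x^2 = 0: expand (a + b)(a + b).\<close>

lemma free_ma_mult_anticomm: "a * b = - (b * a)" for a b :: "('k::field, 'n) free_ma"
proof -
  have sq: "x * x = 0" for x :: "('k, 'n) free_ma"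
    using anticommutative_free_ma unfolding anticommutative_def by blast
  have "0 = (a + b) * (a + b)"
    by (simp add: sq)
  also have "\<dots> = a * a + b * a + (a * b + b * b)"
    by (simp only: ma.mult_add_left ma.mult_add_right)
  also have "\<dots> = a * b + b * a"
    by (simp add: sq add.commute)
  finally have "a * b + b * a = 0"
    by simp
  then show ?thesis
    by (simp add: eq_neg_iff_add_eq_0)
qed

lemma left_normed_swap: "left_normed j i w = - left_normed i j w"
proof (induction w rule: rev_induct)
  case Nil
  then show ?case
    by (simp add: left_normed_Nil free_ma_mult_anticomm[of "gen j"])
next
  case (snoc k w)
  then show ?case
    using ma.mult_scale_left[of "-1" "left_normed i j w" "gen k"] by (simp add: left_normed_snoc)
qed

lemma left_normed_same: "left_normed i i w = (0 :: ('k::field, 'n) free_ma)"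
proof (induction w rule: rev_induct)
  case Nil
  then show ?case
    using anticommutative_free_ma[where 'k='k and 'n='n]
    by (simp add: left_normed_Nil anticommutative_def)
next
  case (snoc k w)
  then show ?case
    using ma.mult_scale_left[of "0::'k" 0 "gen k"] by (simp add: left_normed_snoc)
qed

definition ma_words :: "('k::field, 'n) free_ma set" where
  "ma_words = range gen \<union> {left_normed i j w | i j w. True}"

text \<open>A generator or left-normed word times a generator is again left-normed. A generator
  times a left-normed word reduces to this by anticommutativity, and two left-normed words multiply
  to 0.\<close>

lemma ma_words_mult:
  assumes "a \<in> ma_words" "b \<in> ma_words"
  shows "a * b \<in> ma.span ma_words"
proof -
  have gen_gen: "gen i * gen j \<in> ma.span ma_words" for i j
    by (rule ma.span_base) (auto simp: ma_words_def left_normed_Nil[symmetric])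
  have word_gen: "left_normed i j w * gen k \<in> ma.span ma_words" for i j w k
    by (rule ma.span_base) (auto simp: ma_words_def left_normed_snoc[symmetric])
  have gen_word: "gen k * left_normed i j w \<in> ma.span ma_words" for i j w k
    using ma.span_neg[OF word_gen[of i j w k]]
    by (simp add: free_ma_mult_anticomm[of "gen k"])
  show ?thesis
    using assms gen_gen word_gen gen_word
    by (auto simp: ma_words_def left_normed_mult_left_normed ma.span_zero)
qed

lemma ma_span_words_mult:
  assumes "a \<in> ma.span ma_words" "b \<in> ma.span ma_words"
  shows "a * b \<in> ma.span ma_words"
proof -
  have mult_word: "a * b \<in> ma.span ma_words" if "b \<in> ma_words" for b
    using assms(1)
  proof (induction rule: ma.span_induct_alt)
    case base
    show ?case
      using ma.mult_scale_left[of 0 0 b] by (simp add: ma.span_zero)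
  next
    case (step c x y)
    then show ?case
      using ma_words_mult[OF step(1) that]
      by (simp add: ma.mult_add_left ma.mult_scale_left ma.span_add ma.span_scale)
  qed
  show ?thesis
    using assms(2)
  proof (induction rule: ma.span_induct_alt)
    case base
    show ?case
      using ma.mult_scale_right[of a 0 0] by (simp add: ma.span_zero)
  next
    case (step c x y)
    then show ?case
      using mult_word[OF step(1)]
      by (simp add: ma.mult_add_right ma.mult_scale_right ma.span_add ma.span_scale)
  qed
qed

text \<open>The span contains the generators and is closed under products, so it contains the image
  of every bracketed word, and these images span A.\<close>

lemma span_ma_words: "a \<in> ma.span ma_words"
proof (induction a rule: free_ma.abs_induct)
  case (1 p)
  have single: "abs_free_ma (Poly_Mapping.single t 1) \<in> ma.span ma_words" for t
  proof (induction t)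
    case (Leaf i)
    show ?case
      by (rule ma.span_base) (simp add: gen.abs_eq[symmetric] ma_words_def)
  next
    case (Node t u)
    then show ?case
      using ma_span_words_mult by (fastforce simp: times_free_ma.abs_eq)
  qed
  have lin: "Vector_Spaces.linear pm_scale ma_scale abs_free_ma"
    by unfold_locales (simp_all add: plus_free_ma.abs_eq ma_scale.abs_eq)
  have "abs_free_ma p = lin_ext ma_scale (\<lambda>k. abs_free_ma (Poly_Mapping.single k 1)) p"
    using linear_lin_ext_comp[OF lin, of "\<lambda>k. Poly_Mapping.single k 1" p] by (simp add: lin_ext_id)
  also have "\<dots> \<in> ma.span ma_words"
    unfolding lin_ext_def by (intro ma.span_sum ma.span_scale single)
  finally show ?case .
qed


section \<open>Injectivity of the Fox embedding\<close>

lemma rho_mult: "rho (a * b) = fox_mult (rho a) (rho b)"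
  by (rule rho_hom[unfolded algebra_hom_def, THEN conjunct2, rule_format])

lemma linear_rho: "Vector_Spaces.linear ma_scale fox_scale rho"
  by (rule rho_hom[unfolded algebra_hom_def, THEN conjunct1])

interpretation rho: Vector_Spaces.linear ma_scale fox_scale rho
  by (rule linear_rho)

lemma right_act_axis: "right_act (axis i u) v = axis i (u * v)"
  by (simp add: right_act_def axis_def vec_eq_iff)

lemma right_act_diff: "right_act (a - b) v = right_act a v - right_act b v"
  by (simp add: right_act_def vec_eq_iff left_diff_distrib)

text \<open>The first product is t_i z_j - t_j z_i. It has no Y component, so each further factor
  x_k just multiplies it on the right by z_k.\<close>

lemma rho_left_normed:
  "rho (left_normed i j w) =
     (0, axis i (Poly_Mapping.single (FMon (j # w)) 1) - axis j (Poly_Mapping.single (FMon (i # w)) 1))"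
proof (induction w rule: rev_induct)
  case Nil
  then show ?case
    by (simp add: left_normed_Nil rho_mult rho_gen fox_mult_def R_axis right_act_axis)
next
  case (snoc k w)
  then show ?case
    by (simp add: left_normed_snoc rho_mult rho_gen fox_mult_def R_axis R_zero right_act_axis
        right_act_diff mult_single)
qed

text \<open>
  A left inverse of \<open>rho\<close>, depending on an enumeration \<open>e\<close> of the generators:
  $t_i z_j w$ is sent to $(x_i x_j) w$ for $i < j$ and to $0$ for $i \ge j$.
\<close>

fun retract_word :: "('n \<Rightarrow> nat) \<Rightarrow> 'n \<Rightarrow> 'n fmon \<Rightarrow> ('k::field, 'n) free_ma" where
  "retract_word e i (FMon []) = 0"
| "retract_word e i (FMon (j # w)) = (if e i < e j then left_normed i j w else 0)"

definition retract :: "('n \<Rightarrow> nat) \<Rightarrow> ('k::field, 'n::finite) fox_algebra \<Rightarrow> ('k, 'n) free_ma" where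
  "retract e v =
     (\<Sum>i\<in>UNIV. ma_scale (fst v $ i) (gen i) + lin_ext ma_scale (retract_word e i) (snd v $ i))"

lemma linear_retract: "Vector_Spaces.linear fox_scale ma_scale (retract e)"
  by unfold_locales
    (simp_all add: retract_def fox_scale_def ma.lin_ext_add ma.lin_ext_scale sum.distrib
      ma.scale_left_distrib ma.scale_right_distrib ma.scale_sum_right algebra_simps)

lemma lin_ext_zero [simp]: "lin_ext s f 0 = 0"
  by (simp add: lin_ext_def)

lemma retract_module_axis: "retract e (0, axis i u) = lin_ext ma_scale (retract_word e i) u"
proof -
  have "retract e (0, axis i u) =
      (\<Sum>j\<in>UNIV. if j = i then lin_ext ma_scale (retract_word e j) u else 0)"
    unfolding retract_def by (rule sum.cong) (auto simp: axis_def)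
  then show ?thesis by simp
qed

lemma retract_gen: "retract e (axis i 1, axis i 1) = (gen i :: ('k::field, 'n::finite) free_ma)"
proof -
  have "retract e (axis i 1, axis i 1) =
      (\<Sum>j\<in>UNIV. if j = i then (gen j :: ('k, 'n) free_ma) else 0)"
    unfolding retract_def
  proof (rule sum.cong)
    fix j :: 'n
    show "ma_scale (fst (axis i 1, axis i 1) $ j) (gen j) +
        lin_ext ma_scale (retract_word e j) (snd (axis i 1, axis i 1) $ j) =
        (if j = i then (gen j :: ('k, 'n) free_ma) else 0)"
      \<comment> \<open>The coefficient 1 of t_i is the monomial of the empty word, which
        \<open>retract_word\<close> kills; the generator comes from the Y component alone. The rule
        \<open>single_one\<close> is reversed to expose this monomial.\<close>
      by (auto simp: axis_def zero_fmon_def single_one[symmetric] simp del: single_one)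
  qed simp
  then show ?thesis by simp
qed

text \<open>By linearity it suffices to check spanning words. In t_i z_j w - t_j z_i w with i and j
  distinct, injectivity of \<open>e\<close> lets exactly one term survive; if it is the second, its
  sign is absorbed by swapping the first two letters. For i = j the word itself is 0.\<close>

lemma retract_rho:
  assumes "inj e"
  shows "retract e (rho a) = a"
  using span_ma_words[of a]
proof (induction rule: ma.span_induct_alt)
  interpret retract: Vector_Spaces.linear fox_scale ma_scale "retract e"
    by (rule linear_retract)
  case base
  show ?case
    by (simp add: rho.zero retract.zero)
next
  interpret retract: Vector_Spaces.linear fox_scale ma_scale "retract e"
    by (rule linear_retract)
  case (step c x y)
  have "retract e (rho x) = x"
    using step(1) unfolding ma_words_def
  proof
    assume "x \<in> range gen"
    then show ?thesis by (auto simp: rho_gen retract_gen)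
  next
    assume "x \<in> {left_normed i j w | i j w. True}"
    then obtain i j w where x: "x = left_normed i j w" by blast
    have split: "rho x = (0, axis i (Poly_Mapping.single (FMon (j # w)) 1)) -
        (0, axis j (Poly_Mapping.single (FMon (i # w)) 1))"
      by (simp add: x rho_left_normed)
    have "retract e (rho x) = retract_word e i (FMon (j # w)) - retract_word e j (FMon (i # w))"
      unfolding split retract.diff by (simp add: retract_module_axis)
    moreover have "i = j \<or> e i < e j \<or> e j < e i"
      using assms by (metis injD linorder_neqE_nat)
    ultimately show ?thesis
      by (auto simp: x left_normed_same left_normed_swap[of j i])
  qed
  then show ?case
    by (simp add: rho.add rho.scale retract.add retract.scale step)
qed

theorem inj_rho: "inj (rho :: ('k::field, 'n::finite) free_ma \<Rightarrow> _)"
proof -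
  obtain e :: "'n \<Rightarrow> nat" where "inj e"
    using finite_imp_inj_to_nat_seg[of "UNIV :: 'n set"] by auto
  then show ?thesis
    by (metis injI retract_rho)
qed


section \<open>Elementary endomorphisms\<close>

lemma fst_rho_square:
  assumes "f \<in> ma_square"
  shows "fst (rho f) = 0"
  using assms unfolding ma_square_def
  by (induction rule: ma.span_induct_alt)
    (auto simp: rho.zero rho.add rho.scale rho_mult fox_mult_def fox_scale_def)

text \<open>The T component of a product is a difference of terms m R_a, and R_a has no constant
  term.\<close>

lemma lookup_fox_deriv_square_zero:
  assumes "f \<in> ma_square"
  shows "Poly_Mapping.lookup (fox_deriv i f) 0 = 0"
  using assms unfolding ma_square_def fox_deriv_def
  by (induction rule: ma.span_induct_alt)
    (auto simp: rho.zero rho.add rho.scale rho_mult fox_mult_def fox_scale_def right_act_def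
      lookup_add lookup_minus lookup_mult_fmon_zero lookup_R_zero)

lemma algebra_hom_comp:
  assumes "algebra_hom s1 m1 s2 m2 \<phi>" "algebra_hom s2 m2 s3 m3 \<psi>"
  shows "algebra_hom s1 m1 s3 m3 (\<psi> \<circ> \<phi>)"
  using assms by (auto simp: algebra_hom_def intro: Vector_Spaces.linear_compose)

lemma algebra_endomorphism_eq_id:
  assumes "algebra_endomorphism ma_scale (*) \<phi>" "\<And>i. \<phi> (gen i) = gen i"
  shows "\<phi> = id"
proof -
  have "algebra_endomorphism ma_scale (*) id"
    by (simp add: algebra_hom_def ma.linear_id)
  then show ?thesis
    using free_ma_endomorphism[of gen] assms by (metis id_apply)
qed

text \<open>This is the right U-linear map of T with t_i sent to t_i + d and the other t_j fixed,
  extended by the identity on Y.\<close>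

definition fox_shear ::
  "('k::field, 'n::finite) fox_module \<Rightarrow> 'n \<Rightarrow> ('k, 'n) fox_algebra \<Rightarrow> ('k, 'n) fox_algebra" where
  "fox_shear d i v = (fst v, snd v + right_act d (snd v $ i))"

text \<open>Products in Y + T use only the Y components, which are fixed, and the right action,
  which commutes with the shear.\<close>

lemma fox_shear_hom: "algebra_hom fox_scale fox_mult fox_scale fox_mult (fox_shear d i)"
  unfolding algebra_hom_def
proof
  show "Vector_Spaces.linear fox_scale fox_scale (fox_shear d i)"
    by unfold_locales
      (simp_all add: fox_shear_def fox_scale_def right_act_def vec_eq_iff distrib_left
        pm.scale_right_distrib pm_scale_mult_right)
  show "\<forall>x y. fox_shear d i (fox_mult x y) = fox_mult (fox_shear d i x) (fox_shear d i y)"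
    by (simp add: fox_shear_def fox_mult_def right_act_def vec_eq_iff algebra_simps)
qed

context
  fixes f :: "('k::field, 'n::finite) free_ma"
    and \<delta> :: "('k, 'n) free_ma \<Rightarrow> ('k, 'n) free_ma"
    and i1 :: 'n
  assumes f: "f \<in> ma_square"
    and endo: "algebra_endomorphism ma_scale (*) \<delta>"
    and gen_i1: "\<delta> (gen i1) = gen i1 + f"
    and gen_other: "\<And>i. i \<noteq> i1 \<Longrightarrow> \<delta> (gen i) = gen i"
begin

lemma rho_elementary: "rho (\<delta> a) = fox_shear (snd (rho f)) i1 (rho a)"
proof -
  let ?S = "fox_shear (snd (rho f)) i1"
  have gens: "rho (\<delta> (gen i)) = ?S (rho (gen i))" for i
  proof (cases "i = i1")
    \<comment> \<open>Since f lies in A^2, it has no Y component, so adding f changes only the T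
      component of the image of the generator.\<close>
    case True
    then show ?thesis
      using fst_rho_square[OF f]
      by (simp add: gen_i1 rho.add rho_gen fox_shear_def right_act_def axis_def prod_eq_iff vec_eq_iff)
  next
    case False
    then show ?thesis
      by (simp add: gen_other rho_gen fox_shear_def right_act_def axis_def vec_eq_iff)
  qed
  have "rho \<circ> \<delta> = ?S \<circ> rho"
    using free_ma_universal[OF fox.nonassoc_algebra_axioms anticommutative_fox metabelian_fox,
        of "\<lambda>i. ?S (rho (gen i))"]
      algebra_hom_comp[OF endo rho_hom] algebra_hom_comp[OF rho_hom fox_shear_hom] gens
    by (metis comp_apply)
  then show ?thesis
    by (metis comp_apply)
qed

lemma fox_deriv_elementary: "fox_deriv i1 (\<delta> a) = (1 + fox_deriv i1 f) * fox_deriv i1 a"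
  by (simp add: fox_deriv_def rho_elementary fox_shear_def right_act_def distrib_right)

lemma elementary_fixed:
  assumes "fox_deriv i1 a = 0"
  shows "\<delta> a = a"
proof -
  have "rho (\<delta> a) = rho a"
    using assms
    by (simp add: rho_elementary fox_shear_def fox_deriv_def right_act_def prod_eq_iff vec_eq_iff)
  then show ?thesis
    using inj_rho by (metis injD)
qed

lemma elementary_surj_imp_fox_deriv:
  assumes "surj \<delta>"
  shows "fox_deriv i1 f = 0"
proof -
  obtain a where a: "\<delta> a = gen i1"
    using assms by (metis surjD)
  have "(1 + fox_deriv i1 f) * fox_deriv i1 a = 1"
    using fox_deriv_elementary[of a] by (simp add: a fox_deriv_def rho_gen)
  then have const: "1 + fox_deriv i1 f =
      Poly_Mapping.single 0 (Poly_Mapping.lookup (1 + fox_deriv i1 f) 0)"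
    by (rule free_assoc_unit_const)
  show ?thesis
    \<comment> \<open>The constant term of the derivative vanishes, so the constant on the right is
      1.\<close>
    using const lookup_fox_deriv_square_zero[OF f, of i1]
    by (simp add: lookup_add)
qed

end

theorem lemma5:
  fixes f :: "('k::field, 'n::finite) free_ma"
    and \<delta> :: "('k, 'n) free_ma \<Rightarrow> ('k, 'n) free_ma"
    and i1 :: 'n
  assumes "f \<in> ma_square"
    and "algebra_endomorphism ma_scale (*) \<delta>"
    and "\<delta> (gen i1) = gen i1 + f"
    and "\<And>i. i \<noteq> i1 \<Longrightarrow> \<delta> (gen i) = gen i"
  shows "algebra_automorphism ma_scale (*) \<delta> \<longleftrightarrow> fox_deriv i1 f = 0"
proof
  assume "algebra_automorphism ma_scale (*) \<delta>"
  then show "fox_deriv i1 f = 0"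
    using elementary_surj_imp_fox_deriv[OF assms]
    by (simp add: algebra_automorphism_def bij_is_surj)
next
  assume deriv: "fox_deriv i1 f = 0"
  obtain \<epsilon> where \<epsilon>: "algebra_endomorphism ma_scale (*) \<epsilon>"
    "\<epsilon> (gen i1) = gen i1 + - f" "\<And>i. i \<noteq> i1 \<Longrightarrow> \<epsilon> (gen i) = gen i"
    using free_ma_endomorphism[of "\<lambda>i. if i = i1 then gen i1 + - f else gen i"] by metis
  have neg: "- f \<in> ma_square"
    using assms(1) unfolding ma_square_def by (rule ma.span_neg)
  interpret D: Vector_Spaces.linear ma_scale ma_scale \<delta>
    using assms(2) by (simp add: algebra_hom_def)
  interpret E: Vector_Spaces.linear ma_scale ma_scale \<epsilon>
    using \<epsilon>(1) by (simp add: algebra_hom_def)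
  \<comment> \<open>The map \<open>\<epsilon>\<close> is elementary too, with - f in place of f, so
    both maps fix every element whose derivative in \<open>i1\<close> is 0, in particular f. On the
    generator \<open>i1\<close> the two corrections then cancel in either composite.\<close>
  have fixed: "\<delta> f = f" "\<epsilon> f = f"
    using elementary_fixed[OF assms deriv] elementary_fixed[OF neg \<epsilon> deriv] by simp_all
  have "\<delta> (\<epsilon> (gen i)) = gen i" "\<epsilon> (\<delta> (gen i)) = gen i" for i
    using assms(3,4) \<epsilon>(2,3) fixed by (cases "i = i1"; simp add: D.diff E.add)+
  then have "\<delta> \<circ> \<epsilon> = id" "\<epsilon> \<circ> \<delta> = id"
    using algebra_hom_comp[OF \<epsilon>(1) assms(2)] algebra_hom_comp[OF assms(2) \<epsilon>(1)]
    by (auto intro!: algebra_endomorphism_eq_id)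
  then show "algebra_automorphism ma_scale (*) \<delta>"
    using assms(2) o_bij by (auto simp: algebra_automorphism_def)
qed

end
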